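(* Let $q\in\mathbb{C}$ with $|q|=1$, $q\ne\pm1,\pm i$. Let $A_E$ be the unital complex algebra with three generators $v_1,v_2,v_3$ and relations $$v_jv_i=\frac{v_i^2+q^2v_j^2}{1+q^2},\qquad 1\le i<j\le 3 .$$ Then $A_E$ is polynomial.
   Context: The defining relations are homogeneous, so $A_E$ is graded by degree. The algebra is called polynomial if its subspaces of homogeneous polynomials have the classical dimensions, i.e. for every $d\ge 0$ the homogeneous component of degree $d$ has the same dimension as the space of homogeneous polynomials of degree $d$ in three commuting variables, $\binom{d+2}{2}$. *)

theory Defs
  imports Complex_Main "HOL-Library.Poly_Mapping" "HOL-Algebra.Algebraic_Closure_Type"
    "HOL-Algebra.Embedded_Algebras" "HOL-Algebra.QuotRing"
begin

text \<open>
  Words over an alphabet, written additively so that the convolution product of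
  \<^theory>\<open>HOL-Library.Poly_Mapping\<close> (which needs \<^class>\<open>monoid_add\<close> exponents) becomes the
  product of noncommutative polynomials. A separate type is used because the list type itself
  should not be given a global \<^class>\<open>monoid_add\<close> instance.
\<close>

datatype 'a free_monoid = Free_Monoid (letters: "'a list")

instantiation free_monoid :: (type) monoid_add
begin

definition zero_free_monoid :: "'a free_monoid"
  where "0 = Free_Monoid []"

definition plus_free_monoid :: "'a free_monoid \<Rightarrow> 'a free_monoid \<Rightarrow> 'a free_monoid"
  where "u + w = Free_Monoid (letters u @ letters w)"

instance
  by standard (simp_all add: zero_free_monoid_def plus_free_monoid_def)

end

type_synonym 'a nc_poly = "'a free_monoid \<Rightarrow>\<^sub>0 complex"

definition free_algebra :: "'a set \<Rightarrow> 'a nc_poly ring"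
  where "free_algebra S =
    ring_of_type_algebra \<lparr>carrier := {p. \<forall>w \<in> Poly_Mapping.keys p. set (letters w) \<subseteq> S}\<rparr>"

definition homogeneous_polys :: "'a set \<Rightarrow> nat \<Rightarrow> 'a nc_poly set"
  where "homogeneous_polys S d =
    {p \<in> carrier (free_algebra S). \<forall>w \<in> Poly_Mapping.keys p. length (letters w) = d}"

definition scalar :: "complex \<Rightarrow> 'a nc_poly"
  where "scalar c = Poly_Mapping.single 0 c"

definition gen :: "'a \<Rightarrow> 'a nc_poly"
  where "gen i = Poly_Mapping.single (Free_Monoid [i]) 1"

lemma ring_free_algebra: "ring (free_algebra S)"
proof -
  define C where "C = {p :: 'a nc_poly. \<forall>w \<in> Poly_Mapping.keys p. set (letters w) \<subseteq> S}"
  have add: "p + r \<in> C" if "p \<in> C" "r \<in> C" for p r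
    using that Poly_Mapping.keys_add[of p r] unfolding C_def by blast
  have mult: "p * r \<in> C" if p: "p \<in> C" and r: "r \<in> C" for p r
    unfolding C_def
  proof (intro CollectI ballI)
    fix w assume "w \<in> Poly_Mapping.keys (p * r)"
    then obtain u v where "w = u + v" "u \<in> Poly_Mapping.keys p" "v \<in> Poly_Mapping.keys r"
      using keys_mult[of p r] by blast
    then show "set (letters w) \<subseteq> S"
      using p r by (simp add: C_def plus_free_monoid_def)
  qed
  have neg: "- p \<in> C" if "p \<in> C" for p
    using that by (simp add: C_def)
  have zero: "0 \<in> C" and one: "1 \<in> C"
    by (simp_all add: C_def zero_free_monoid_def)
  let ?R = "\<lparr>carrier = C, monoid.mult = (*), one = 1, ring.zero = 0, add = (+)\<rparr>"
  have eq: "free_algebra S = ?R"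
    by (simp add: free_algebra_def ring_of_type_algebra_def C_def)
  show ?thesis
    unfolding eq
  proof (intro ringI abelian_groupI monoidI)
    fix p assume "p \<in> carrier ?R"
    then show "\<exists>r \<in> carrier ?R. r \<oplus>\<^bsub>?R\<^esub> p = \<zero>\<^bsub>?R\<^esub>"
      using neg by (intro bexI[of _ "- p"]) simp_all
  qed (simp_all add: add mult zero one mult.assoc add.assoc add.commute distrib_left distrib_right)
qed

text \<open>
  \<open>relator q i j\<close> is the difference of the two sides of
  \<open>v\<^sub>j v\<^sub>i = (v\<^sub>i\<^sup>2 + q\<^sup>2 v\<^sub>j\<^sup>2) / (1 + q\<^sup>2)\<close>.
\<close>

definition relator :: "complex \<Rightarrow> nat \<Rightarrow> nat \<Rightarrow> nat nc_poly"
  where "relator q i j =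
    gen j * gen i - scalar (1 / (1 + q^2)) * ((gen i)^2 + scalar (q^2) * (gen j)^2)"

definition A_E_ideal :: "complex \<Rightarrow> nat nc_poly set"
  where "A_E_ideal q =
    Idl\<^bsub>free_algebra {1..3}\<^esub> {relator q i j | i j. 1 \<le> i \<and> i < j \<and> j \<le> 3}"

definition A_E :: "complex \<Rightarrow> nat nc_poly set ring"
  where "A_E q = free_algebra {1..3} Quot A_E_ideal q"

definition A_E_class :: "complex \<Rightarrow> nat nc_poly \<Rightarrow> nat nc_poly set"
  where "A_E_class q p = A_E_ideal q +>\<^bsub>free_algebra {1..3}\<^esub> p"

definition A_E_scalars :: "complex \<Rightarrow> nat nc_poly set set"
  where "A_E_scalars q = A_E_class q ` range scalar"

text \<open>
  Since the relators are homogeneous, the images of the homogeneous components of the free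
  algebra are the homogeneous components of the quotient.
\<close>

definition A_E_component :: "complex \<Rightarrow> nat \<Rightarrow> nat nc_poly set set"
  where "A_E_component q d = A_E_class q ` homogeneous_polys {1..3} d"

text \<open>
  For an algebra \<open>A\<close> over its subfield \<open>K\<close> with homogeneous components \<open>H d\<close>: the dimensions agree
  with those for polynomials in three commuting variables. \<^const>\<open>ring.dimension\<close> is a relation,
  so this includes that every \<open>H d\<close> has finite dimension.
\<close>

definition polynomial_algebra :: "('a, 'b) ring_scheme \<Rightarrow> 'a set \<Rightarrow> (nat \<Rightarrow> 'a set) \<Rightarrow> bool"
  where "polynomial_algebra A K H \<longleftrightarrow> (\<forall>d. ring.dimension A ((d + 2) choose 2) K (H d))"

end

(*
  Put t = q^2, k = t / (1 - t), and pass to the generators u = v2 - v1, v = v3 - v2 and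
  x = v1 - k (u + v). In these the relations become triangular:
    v u = 0,   u x = t x u - k u v,   v x = t x v + k u v,
  so the words x^a u^b v^c with a + b + c = d span the component of degree d. For their linear
  independence, u, v, x act on the functions on triples (a, b, c) by the transposes of right
  multiplication on x^a u^b v^c; the relations hold for these operators, and the action of
  x^a u^b v^c followed by evaluation at (0, 0, 0) is evaluation at (a, b, c).
*)

theory Submission
  imports Defs
begin

section \<open>The free algebra as a vector space\<close>

lemma free_algebra_simps [simp]:
  "monoid.mult (free_algebra S) = (*)" "add (free_algebra S) = (+)"
  "one (free_algebra S) = 1" "zero (free_algebra S) = 0"
  by (simp_all add: free_algebra_def ring_of_type_algebra_def fun_eq_iff)

lemma carrier_free_algebra:
  "carrier (free_algebra S) = {p. \<forall>w \<in> Poly_Mapping.keys p. set (letters w) \<subseteq> S}"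
  by (simp add: free_algebra_def ring_of_type_algebra_def)

lemma keys_scalar: "Poly_Mapping.keys (scalar c) \<subseteq> {0}"
  by (simp add: scalar_def)

lemma scalar_in_carrier [simp]: "scalar c \<in> carrier (free_algebra S)"
  using keys_scalar[of c] by (auto simp: carrier_free_algebra zero_free_monoid_def)

lemma gen_in_carrier: "i \<in> S \<Longrightarrow> gen i \<in> carrier (free_algebra S)"
  by (simp add: carrier_free_algebra gen_def)

lemma scalar_add: "scalar (c + d) = scalar c + scalar d"
  by (simp add: scalar_def single_add)

lemma scalar_diff: "scalar (c - d) = scalar c - scalar d"
  by (simp add: scalar_def single_diff)

lemma scalar_mult: "scalar (c * d) = scalar c * scalar d"
  by (simp add: scalar_def mult_single)

lemma scalar_0 [simp]: "scalar 0 = 0" and scalar_1 [simp]: "scalar 1 = 1"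
  by (simp_all add: scalar_def)

text \<open>Lets an identity additive in \<open>p\<close> be checked on multiples of single
  words.\<close>

lemma nc_poly_induct [case_names single add]:
  fixes p :: "'a nc_poly"
  assumes single: "\<And>w c. P (Poly_Mapping.single w c)" and add: "\<And>p r. P p \<Longrightarrow> P r \<Longrightarrow> P (p + r)"
  shows "P p"
proof (induction p rule: update_induct)
  case const
  then show ?case using single[of 0 0] by simp
next
  case (update p w c)
  have "Poly_Mapping.update w c p = p + Poly_Mapping.single w c"
    using update.hyps
    by (intro poly_mapping_eqI) (auto simp: lookup_update lookup_add lookup_single in_keys_iff when_def)
  then show ?case using add[OF update.IH single[of w c]] by simp
qed

lemma scalar_commute: "p * scalar c = scalar c * p"
  by (induction p rule: nc_poly_induct) (simp_all add: scalar_def mult_single algebra_simps)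

lemma nc_scale_left: "p * (scalar c * r) = scalar c * (p * r)"
  by (simp add: scalar_commute mult.assoc[symmetric])

text \<open>Left multiplication by constants is the vector space structure, so that
  \<open>nc.span\<close> and \<open>nc.subspace\<close> can be used next to the ring structure of
  \<open>free_algebra S\<close>.\<close>

interpretation nc: vector_space "\<lambda>c p. scalar c * p"
  by standard (simp_all add: scalar_add scalar_mult algebra_simps)

lemma subspace_free_algebra: "nc.subspace (carrier (free_algebra S))"
proof -
  interpret ring "free_algebra S" by (rule ring_free_algebra)
  show ?thesis using m_closed a_closed zero_closed by (intro nc.subspaceI) auto
qed

section \<open>The action of the free algebra defined by linear operators\<close>

text \<open>The functions on \<open>'m\<close> form the dual of the space with basis
  \<open>'m\<close>, so transposes of linear maps on that space are operators of this kind.\<close>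

locale linear_operators =
  fixes T :: "'i \<Rightarrow> ('m \<Rightarrow> complex) \<Rightarrow> 'm \<Rightarrow> complex"
  assumes T_add: "T i (\<lambda>m. g m + h m) = (\<lambda>m. T i g m + T i h m)"
    and T_scale: "T i (\<lambda>m. c * g m) = (\<lambda>m. c * T i g m)"
begin

text \<open>\<open>foldr\<close> applies the last letter of a word first, so a product acts as the
  composition in the same order.\<close>

definition act :: "'i nc_poly \<Rightarrow> ('m \<Rightarrow> complex) \<Rightarrow> 'm \<Rightarrow> complex"
  where "act p g m = (\<Sum>w \<in> Poly_Mapping.keys p. Poly_Mapping.lookup p w * foldr T (letters w) g m)"

lemma foldr_T_linear:
  "foldr T l (\<lambda>m. g m + h m) = (\<lambda>m. foldr T l g m + foldr T l h m)"
  "foldr T l (\<lambda>m. c * g m) = (\<lambda>m. c * foldr T l g m)"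
  by (induction l) (simp_all add: T_add T_scale)

lemma act_superset:
  assumes "finite A" "Poly_Mapping.keys p \<subseteq> A"
  shows "act p g m = (\<Sum>w \<in> A. Poly_Mapping.lookup p w * foldr T (letters w) g m)"
  unfolding act_def using assms by (intro sum.mono_neutral_left) (auto simp: in_keys_iff)

lemma act_add: "act (p + r) g = (\<lambda>m. act p g m + act r g m)"
proof
  fix m
  let ?A = "Poly_Mapping.keys p \<union> Poly_Mapping.keys r"
  show "act (p + r) g m = act p g m + act r g m"
    using keys_add[of p r]
    by (simp add: act_superset[of ?A] lookup_add distrib_right sum.distrib)
qed

lemma act_single: "act (Poly_Mapping.single w c) g = (\<lambda>m. c * foldr T (letters w) g m)"
  by (simp add: act_superset[of "{w}"] fun_eq_iff)

lemma act_linear: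
  "act p (\<lambda>m. g m + h m) = (\<lambda>m. act p g m + act p h m)"
  "act p (\<lambda>m. c * g m) = (\<lambda>m. c * act p g m)"
  by (simp_all add: act_def foldr_T_linear fun_eq_iff algebra_simps sum.distrib sum_distrib_left)

lemma act_scalar [simp]: "act (scalar c) g = (\<lambda>m. c * g m)"
  by (simp add: scalar_def act_single zero_free_monoid_def)

lemma act_gen [simp]: "act (gen i) g = T i g"
  by (simp add: gen_def act_single)

lemma act_one [simp]: "act 1 g = g"
  using act_scalar[of 1 g] by simp

lemma act_zero [simp]: "act 0 g = (\<lambda>m. 0)" "act p (\<lambda>m. 0) = (\<lambda>m. 0)"
  by (simp_all add: act_def fun_eq_iff) (use act_linear(2)[of p 0] in \<open>simp add: act_def fun_eq_iff\<close>)

lemma act_mult [simp]: "act (p * r) g = act p (act r g)"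
proof (induction p rule: nc_poly_induct)
  case (single w c)
  show ?case
  proof (induction r rule: nc_poly_induct)
    case (single w' c')
    then show ?case
      by (simp add: mult_single act_single plus_free_monoid_def foldr_T_linear algebra_simps)
  next
    case (add r r')
    then show ?case by (simp add: distrib_left act_add act_linear)
  qed
next
  case (add p p')
  then show ?case by (simp add: distrib_right act_add)
qed

lemma act_diff: "act (p - r) g = (\<lambda>m. act p g m - act r g m)"
  using act_add[of "p - r" r g] by (simp add: fun_eq_iff)

lemma act_power: "act (p ^ n) g = (act p ^^ n) g"
  by (induction n) simp_all

text \<open>The elements that annihilate every function form a two-sided ideal. Annihilating all
  functions, not just \<open>g\<close>, is what makes it closed under right multiplication.\<close>

lemma act_genideal:
  assumes "B \<subseteq> carrier (free_algebra S)" and "p \<in> Idl\<^bsub>free_algebra S\<^esub> B"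
    and "\<And>r g. r \<in> B \<Longrightarrow> act r g = (\<lambda>m. 0)"
  shows "act p g = (\<lambda>m. 0)"
proof -
  interpret R: ring "free_algebra S" by (rule ring_free_algebra)
  let ?N = "{p \<in> carrier (free_algebra S). \<forall>g. act p g = (\<lambda>m. 0)}"
  \<comment> \<open>The ring-theoretic inverse is defined relative to the carrier and has to be
    identified with the minus of the type.\<close>
  have neg: "\<ominus>\<^bsub>free_algebra S\<^esub> p = - p" if "p \<in> carrier (free_algebra S)" for p
    using R.r_neg[OF that] by (simp add: eq_neg_iff_add_eq_0 add.commute)
  have "ideal ?N (free_algebra S)"
  proof (intro idealI ring_free_algebra, unfold_locales)
    show "?N \<subseteq> carrier (add_monoid (free_algebra S))" by auto
    show "inv\<^bsub>add_monoid (free_algebra S)\<^esub> p \<in> ?N" if "p \<in> ?N" for p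
    proof -
      have "- p \<in> ?N"
        using that neg[of p] R.a_inv_closed[of p] act_diff[of 0 p] by simp
      moreover have "inv\<^bsub>add_monoid (free_algebra S)\<^esub> p = - p"
        using that neg[of p] by (simp only: a_inv_def mem_Collect_eq)
      ultimately show ?thesis by (simp only:)
    qed
  qed (use R.a_closed R.m_closed R.zero_closed in \<open>auto simp: act_add\<close>)
  moreover have "B \<subseteq> ?N" using assms by auto
  ultimately have "Idl\<^bsub>free_algebra S\<^esub> B \<subseteq> ?N"
    by (rule R.genideal_minimal)
  then show ?thesis using assms(2) by auto
qed

end

section \<open>Dimensions in quotients of the free algebra\<close>

context
  fixes S :: "'a set" and I :: "'a nc_poly set" and cls :: "'a nc_poly \<Rightarrow> 'a nc_poly set"
  assumes I: "ideal I (free_algebra S)"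
  defines "cls \<equiv> \<lambda>p. I +>\<^bsub>free_algebra S\<^esub> p"
begin

interpretation ideal I "free_algebra S" by (rule I)

lemma subspace_ideal: "nc.subspace I"
  using I_l_closed additive_subgroup.a_closed[OF additive_subgroup_axioms]
    additive_subgroup.zero_closed[OF additive_subgroup_axioms]
  by (intro nc.subspaceI) auto

lemma cls_eq_iff:
  assumes "p \<in> carrier (free_algebra S)" "r \<in> carrier (free_algebra S)"
  shows "cls p = cls r \<longleftrightarrow> p - r \<in> I"
proof -
  have "\<ominus>\<^bsub>free_algebra S\<^esub> r = - r"
    using r_neg[OF assms(2)] by (simp add: eq_neg_iff_add_eq_0 add.commute)
  then show ?thesis
    using quotient_eq_iff_same_a_r_cos[OF I assms] by (simp add: cls_def a_minus_def)
qed

text \<open>\<open>ring.dimension\<close> builds a space up one line at a time; such a step in the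
  quotient comes from adjoining one vector to a span in the free algebra.\<close>

lemma line_extension_quotient:
  assumes "u \<in> carrier (free_algebra S)" "B \<subseteq> carrier (free_algebra S)"
  shows "ring.line_extension (free_algebra S Quot I) (cls ` range scalar) (cls u) (cls ` nc.span B) =
    cls ` nc.span (insert u B)"
proof -
  have B: "nc.span B \<subseteq> carrier (free_algebra S)"
    using assms(2) subspace_free_algebra by (rule nc.span_minimal)
  have lc: "cls (scalar c) \<otimes>\<^bsub>free_algebra S Quot I\<^esub> cls u \<oplus>\<^bsub>free_algebra S Quot I\<^esub> cls p =
      cls (scalar c * u + p)" if "p \<in> nc.span B" for c p
    using that B assms(1) rcoset_mult_add[of "scalar c" u] a_rcos_sum[of "scalar c * u" p]
      m_closed[of "scalar c" u]
    by (auto simp: FactRing_def cls_def)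
  have "ring.line_extension (free_algebra S Quot I) (cls ` range scalar) (cls u) (cls ` nc.span B)
      = {cls (scalar c * u + p) |c p. p \<in> nc.span B}"
    by (auto simp: ring.line_extension_mem_iff[OF quotient_is_ring] lc) (metis lc)+
  \<comment> \<open>\<open>nc.span_insert\<close> describes the span by
    \<open>x - scalar c * u\<close> lying in \<open>nc.span B\<close>; that difference is the
    \<open>p\<close> of the previous line.\<close>
  also have "\<dots> = cls ` nc.span (insert u B)"
    unfolding nc.span_insert image_def
    by (auto) (metis add_diff_cancel_left' diff_add_cancel add.commute)+
  finally show ?thesis .
qed

text \<open>The functionals \<open>\<phi> m\<close> vanish on the ideal, hence descend to the
  quotient, where they are dual to the classes of the \<open>B m\<close>. These classes are
  therefore independent.\<close>

lemma dimension_quotient_span: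
  fixes B :: "'b \<Rightarrow> 'a nc_poly" and \<phi> :: "'b \<Rightarrow> 'a nc_poly \<Rightarrow> complex"
  assumes "finite D" and "\<And>m. m \<in> D \<Longrightarrow> B m \<in> carrier (free_algebra S)"
    and \<phi>_add: "\<And>m p r. \<phi> m (p + r) = \<phi> m p + \<phi> m r"
    and \<phi>_scale: "\<And>m c p. \<phi> m (scalar c * p) = c * \<phi> m p"
    and \<phi>_ideal: "\<And>m p. p \<in> I \<Longrightarrow> \<phi> m p = 0"
    and \<phi>_B: "\<And>m n. \<phi> m (B n) = (if m = n then 1 else 0)"
  shows "ring.dimension (free_algebra S Quot I) (card D) (cls ` range scalar) (cls ` nc.span (B ` D))"
  using assms(1,2)
proof (induction D rule: finite_induct)
  case empty
  have "cls 0 = \<zero>\<^bsub>free_algebra S Quot I\<^esub>"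
    using a_rcos_const[of 0] additive_subgroup.zero_closed[OF additive_subgroup_axioms]
    by (simp add: cls_def FactRing_def)
  then show ?case
    using ring.zero_dim[OF quotient_is_ring, of "cls ` range scalar"] by simp
next
  case (insert m D)
  have "B ` D \<subseteq> carrier (free_algebra S)" using insert.prems by auto
  note le = line_extension_quotient[OF _ this, of "B m"]
  \<comment> \<open>\<open>\<phi> m\<close> separates \<open>B m\<close> from the span of the
    vectors already adjoined.\<close>
  have span: "nc.span (B ` D) \<subseteq> carrier (free_algebra S) \<inter> {p. \<phi> m p = 0}"
  proof (rule nc.span_minimal)
    show "B ` D \<subseteq> carrier (free_algebra S) \<inter> {p. \<phi> m p = 0}"
      using insert.prems insert.hyps \<phi>_B by auto
    show "nc.subspace (carrier (free_algebra S) \<inter> {p. \<phi> m p = 0})"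
      using subspace_free_algebra \<phi>_ideal[of 0 m] nc.subspace_0[OF subspace_ideal]
      by (auto simp: nc.subspace_def \<phi>_add \<phi>_scale)
  qed
  have "cls (B m) \<notin> cls ` nc.span (B ` D)"
  proof
    assume "cls (B m) \<in> cls ` nc.span (B ` D)"
    then obtain p where p: "p \<in> nc.span (B ` D)" "cls (B m) = cls p" by auto
    then have "B m - p \<in> I" using cls_eq_iff[of "B m" p] span insert.prems by auto
    then have "\<phi> m (B m) = \<phi> m p"
      using \<phi>_ideal[of "B m - p" m] \<phi>_add[of m "B m - p" p] by simp
    then show False using p span by (auto simp: \<phi>_B)
  qed
  moreover have "cls (B m) \<in> carrier (free_algebra S Quot I)"
    using insert.prems a_rcosetsI[OF a_subset] by (simp add: cls_def FactRing_def)
  ultimately show ?case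
    using ring.Suc_dim[OF quotient_is_ring, of "cls (B m)" "cls ` nc.span (B ` D)" "card D"
        "cls ` range scalar"] insert le by simp
qed

end

section \<open>A triangular presentation of the algebra\<close>

text \<open>Keeps the index in \<open>gen 1\<close> from being rewritten to
  \<open>Suc 0\<close>.\<close>

declare One_nat_def [simp del]

definition pbw_u :: "nat nc_poly"
  where "pbw_u = gen 2 - gen 1"

definition pbw_v :: "nat nc_poly"
  where "pbw_v = gen 3 - gen 2"

text \<open>With \<open>t = q^2\<close>, the relation of \<open>u\<close> and \<open>gen 1\<close>
  reads u v1 = t v1 u + t u^2. Shifting by \<open>k\<close> with \<open>k * (1 - t) = t\<close>
  removes the squares of \<open>u\<close> and \<open>v\<close>.\<close>

definition pbw_x :: "complex \<Rightarrow> nat nc_poly"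
  where "pbw_x k = gen 1 - scalar k * (pbw_u + pbw_v)"

fun pbw_monomial :: "complex \<Rightarrow> nat \<times> nat \<times> nat \<Rightarrow> nat nc_poly"
  where "pbw_monomial k (a, b, c) = pbw_x k ^ a * pbw_u ^ b * pbw_v ^ c"

definition monomials :: "nat \<Rightarrow> (nat \<times> nat \<times> nat) set"
  where "monomials d = {(a, b, c). a + b + c = d}"

lemma gen_eq_pbw:
  "gen 1 = pbw_x k + scalar k * (pbw_u + pbw_v)"
  "gen 2 = pbw_x k + scalar k * (pbw_u + pbw_v) + pbw_u"
  "gen 3 = pbw_x k + scalar k * (pbw_u + pbw_v) + pbw_u + pbw_v"
  by (simp_all add: pbw_x_def pbw_u_def pbw_v_def)

text \<open>Multiplication by \<open>1 + t\<close> clears the denominator, and both sides are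
  expanded in the \<open>gen i\<close>. The third identity isolates \<open>pbw_v * pbw_u\<close> as
  a combination of relators.\<close>

lemma relator_pbw:
  fixes q k :: complex
  defines "t \<equiv> q\<^sup>2"
  assumes t: "1 + t \<noteq> 0" and k: "k * (1 - t) = t"
  shows "scalar (1 + t) * relator q 1 2 =
      pbw_u * pbw_x k - scalar t * (pbw_x k * pbw_u) + scalar k * (pbw_u * pbw_v)
      - scalar (t * k) * (pbw_v * pbw_u)" (is ?A)
    and "scalar (1 + t) * relator q 2 3 =
      pbw_v * pbw_x k - scalar t * (pbw_x k * pbw_v) - scalar k * (pbw_u * pbw_v)
      + scalar (1 + k) * (pbw_v * pbw_u)" (is ?B)
    and "relator q 1 3 = relator q 1 2 + relator q 2 3 - pbw_v * pbw_u" (is ?C)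
proof -
  have rel: "scalar (1 + t) * relator q i j =
      gen j * gen i + scalar t * (gen j * gen i) - (gen i * gen i + scalar t * (gen j * gen j))"
    for i j
    unfolding relator_def t_def[symmetric] right_diff_distrib mult.assoc[symmetric]
      scalar_mult[symmetric]
    using t by (simp add: scalar_add distrib_right mult.assoc power2_eq_square)
  \<comment> \<open>This form of the condition on \<open>k\<close> serves as a rewrite rule that
    eliminates all products of \<open>k\<close> and \<open>t\<close>, so that the expansions agree
    literally.\<close>
  have "k * t = k - t" "t * k = k - t" using k by (simp_all add: algebra_simps)
  then have kt: "scalar k * scalar t = (scalar k - scalar t :: nat nc_poly)"
    "scalar t * scalar k = (scalar k - scalar t :: nat nc_poly)"
    by (metis scalar_mult scalar_diff)+
  have kt': "scalar k * (scalar t * p) = scalar k * p - scalar t * p"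
    "scalar t * (scalar k * p) = scalar k * p - scalar t * p" for p :: "nat nc_poly"
    by (simp_all add: mult.assoc[symmetric] left_diff_distrib kt)
  have comm: "gen i * scalar c = scalar c * gen i"
    "gen i * (scalar c * p) = scalar c * (gen i * p)" for i :: nat and c p
    by (simp_all add: scalar_commute mult.assoc[symmetric])
  note simps = pbw_x_def pbw_u_def pbw_v_def scalar_add scalar_mult kt kt' comm algebra_simps
  show ?A ?B unfolding rel by (simp_all add: simps)
  \<comment> \<open>The two sides are compared after multiplication by \<open>1 + t\<close>, which
    is then cancelled.\<close>
  have "scalar (1 + t) * relator q 1 3 =
      scalar (1 + t) * (relator q 1 2 + relator q 2 3 - pbw_v * pbw_u)"
    unfolding distrib_left right_diff_distrib rel by (simp add: simps)
  then show ?C using t by simp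
qed

section \<open>Linear independence of the normal words\<close>

text \<open>Read off from u^b v^c x = t^(b+c) x u^b v^c - k t^c u^b v^(c+1) + k t^(c-1) u^(b+1) v^c.
  Since v u = 0, each block of letters leaves one correction term, absent when that block is
  empty.\<close>

definition x_op :: "complex \<Rightarrow> complex \<Rightarrow> (nat \<times> nat \<times> nat \<Rightarrow> complex) \<Rightarrow> nat \<times> nat \<times> nat \<Rightarrow> complex"
  where "x_op t k g = (\<lambda>(a, b, c). t ^ (b + c) * g (Suc a, b, c)
    - (if b = 0 then 0 else k * t ^ c * g (a, b, Suc c))
    + (if c = 0 then 0 else k * t ^ (c - 1) * g (a, Suc b, c)))"

text \<open>A word ending in v is killed by u on the right, because v u = 0.\<close>

definition u_op :: "(nat \<times> nat \<times> nat \<Rightarrow> complex) \<Rightarrow> nat \<times> nat \<times> nat \<Rightarrow> complex"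
  where "u_op g = (\<lambda>(a, b, c). if c = 0 then g (a, Suc b, c) else 0)"

definition v_op :: "(nat \<times> nat \<times> nat \<Rightarrow> complex) \<Rightarrow> nat \<times> nat \<times> nat \<Rightarrow> complex"
  where "v_op g = (\<lambda>(a, b, c). g (a, b, Suc c))"

text \<open>The expression of \<open>gen i\<close> through x, u and v as in
  \<open>gen_eq_pbw\<close>, extended to all indices.\<close>

definition gen_op ::
    "complex \<Rightarrow> complex \<Rightarrow> nat \<Rightarrow> (nat \<times> nat \<times> nat \<Rightarrow> complex) \<Rightarrow> nat \<times> nat \<times> nat \<Rightarrow> complex"
  where "gen_op t k i g = (\<lambda>m. x_op t k g m + k * (u_op g m + v_op g m)
    + (if 2 \<le> i then u_op g m else 0) + (if 3 \<le> i then v_op g m else 0))"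

text \<open>A case check on whether b and c vanish. In the third relation the term with
  \<open>k\<close> comes from \<open>u_op\<close> if c = 0 and from \<open>x_op\<close>
  otherwise.\<close>

lemma op_relations:
  "v_op (u_op g) = (\<lambda>m. 0)"
  "u_op (x_op t k g) = (\<lambda>m. t * x_op t k (u_op g) m - k * u_op (v_op g) m)"
  "v_op (x_op t k g) = (\<lambda>m. t * x_op t k (v_op g) m + k * u_op (v_op g) m)"
  by (auto simp: fun_eq_iff x_op_def u_op_def v_op_def algebra_simps gr0_conv_Suc)

interpretation gen_op: linear_operators "gen_op t k" for t k
  by standard (simp_all add: gen_op_def x_op_def u_op_def v_op_def fun_eq_iff algebra_simps)

lemma act_pbw [simp]:
  "gen_op.act t k pbw_u g = u_op g"
  "gen_op.act t k pbw_v g = v_op g"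
  "gen_op.act t k (pbw_x k) g = x_op t k g"
  by (simp_all add: pbw_u_def pbw_v_def pbw_x_def gen_op.act_diff gen_op.act_add)
    (simp_all add: gen_op_def fun_eq_iff)

text \<open>The evaluation point moves from the origin along a, then b, then c. At b = c = 0 the
  corrections in \<open>x_op\<close> are absent, and at c = 0 \<open>u_op\<close> is a plain
  shift.\<close>

lemma act_pbw_monomial: "gen_op.act t k (pbw_monomial k (a, b, c)) g (0, 0, 0) = g (a, b, c)"
proof -
  have "(x_op t k ^^ a) g (a', 0, 0) = g (a + a', 0, 0)" for g a'
    by (induction a arbitrary: g a') (simp_all add: x_op_def)
  moreover have "(u_op ^^ b) g (a, b', 0) = g (a, b + b', 0)" for g b'
    by (induction b arbitrary: g b') (simp_all add: u_op_def)
  moreover have "(v_op ^^ c) g (a, b, c') = g (a, b, c + c')" for g c'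
    by (induction c arbitrary: g c') (simp_all add: v_op_def)
  moreover have "gen_op.act t k (pbw_x k) = x_op t k" "gen_op.act t k pbw_u = u_op"
    "gen_op.act t k pbw_v = v_op"
    by (simp_all add: fun_eq_iff)
  ultimately show ?thesis by (simp add: gen_op.act_power)
qed

text \<open>By \<open>relator_pbw\<close> a relator is, up to the nonzero factor
  \<open>1 + q^2\<close>, a combination of the relations in \<open>op_relations\<close>.\<close>

lemma act_relator:
  assumes t: "1 + q\<^sup>2 \<noteq> 0" and k: "k * (1 - q\<^sup>2) = q\<^sup>2"
    and ij: "1 \<le> i" "i < j" "j \<le> 3"
  shows "gen_op.act (q\<^sup>2) k (relator q i j) g = (\<lambda>m. 0)"
proof -
  let ?act = "gen_op.act (q\<^sup>2) k"
  have cancel: "?act r g = (\<lambda>m. 0)" if "?act (scalar (1 + q\<^sup>2) * r) g = (\<lambda>m. 0)" for r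
    using that t by (auto simp: fun_eq_iff)
  have r12: "?act (relator q 1 2) g = (\<lambda>m. 0)"
    by (rule cancel, subst relator_pbw(1)[OF t k])
      (simp add: gen_op.act_diff gen_op.act_add op_relations)
  have r23: "?act (relator q 2 3) g = (\<lambda>m. 0)"
    by (rule cancel, subst relator_pbw(2)[OF t k])
      (simp add: gen_op.act_diff gen_op.act_add op_relations)
  have "?act (relator q 1 3) g = (\<lambda>m. 0)"
    by (subst relator_pbw(3)[OF t k])
      (simp add: gen_op.act_diff gen_op.act_add op_relations r12 r23)
  moreover have "(i, j) \<in> {(1, 2), (2, 3), (1, 3)}" using ij by auto
  ultimately show ?thesis using r12 r23 by auto
qed

section \<open>The normal words span\<close>

context
  fixes q k :: complex
  assumes t: "1 + q\<^sup>2 \<noteq> 0" and k: "k * (1 - q\<^sup>2) = q\<^sup>2"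
begin

abbreviation F :: "nat nc_poly ring"
  where "F \<equiv> free_algebra {1..3}"

lemma ring_gens_in_carrier [simp]:
  "gen 1 \<in> carrier F" "gen 2 \<in> carrier F" "gen 3 \<in> carrier F"
  by (simp_all add: gen_in_carrier)

lemma carrier_mult: "p \<in> carrier F \<Longrightarrow> r \<in> carrier F \<Longrightarrow> p * r \<in> carrier F"
  using monoid.m_closed[OF ring.is_monoid[OF ring_free_algebra]] by fastforce

lemma carrier_diff: "p \<in> carrier F \<Longrightarrow> r \<in> carrier F \<Longrightarrow> p - r \<in> carrier F"
  by (rule nc.subspace_diff[OF subspace_free_algebra])

lemma pbw_in_carrier [simp]: "pbw_u \<in> carrier F" "pbw_v \<in> carrier F" "pbw_x k \<in> carrier F"
  by (simp_all add: pbw_u_def pbw_v_def pbw_x_def carrier_mult carrier_diff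
      nc.subspace_add[OF subspace_free_algebra])

lemma carrier_power: "p \<in> carrier F \<Longrightarrow> p ^ n \<in> carrier F"
  using scalar_in_carrier[of 1 "{1..3::nat}"] by (induction n) (simp_all add: carrier_mult)

lemma pbw_monomial_in_carrier: "pbw_monomial k m \<in> carrier F"
  by (cases m) (simp add: carrier_mult carrier_power)

lemma relators_in_carrier: "{relator q i j |i j. 1 \<le> i \<and> i < j \<and> j \<le> 3} \<subseteq> carrier F"
  by (auto simp: relator_def power2_eq_square intro!: carrier_diff carrier_mult
      nc.subspace_add[OF subspace_free_algebra] gen_in_carrier)

lemma ideal_A_E: "ideal (A_E_ideal q) F"
  unfolding A_E_ideal_def by (intro ring.genideal_ideal ring_free_algebra relators_in_carrier)

lemma ideal_mult:
  assumes "p \<in> A_E_ideal q" "r \<in> carrier F"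
  shows "p * r \<in> A_E_ideal q" "r * p \<in> A_E_ideal q"
  using ideal.I_l_closed[OF ideal_A_E] ideal.I_r_closed[OF ideal_A_E] assms by auto

lemmas subspace_A_E_ideal = subspace_ideal[OF ideal_A_E]

text \<open>\<open>relator_pbw\<close> is solved for the triangular relations: first v u, which is
  then used to remove the v u terms from the other two.\<close>

lemma pbw_relations_in_ideal:
  "pbw_v * pbw_u \<in> A_E_ideal q"
  "pbw_u * pbw_x k - scalar (q\<^sup>2) * (pbw_x k * pbw_u) + scalar k * (pbw_u * pbw_v) \<in> A_E_ideal q"
  "pbw_v * pbw_x k - scalar (q\<^sup>2) * (pbw_x k * pbw_v) - scalar k * (pbw_u * pbw_v) \<in> A_E_ideal q"
proof -
  note add = nc.subspace_add[OF subspace_A_E_ideal]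
    and diff = nc.subspace_diff[OF subspace_A_E_ideal]
    and scale = nc.subspace_scale[OF subspace_A_E_ideal]
  have rel: "relator q i j \<in> A_E_ideal q" if "1 \<le> i" "i < j" "j \<le> 3" for i j
    using ring.genideal_self[OF ring_free_algebra relators_in_carrier] that
    unfolding A_E_ideal_def by blast
  have "relator q 1 2 + relator q 2 3 - relator q 1 3 \<in> A_E_ideal q"
    by (intro add diff rel) simp_all
  then show vu: "pbw_v * pbw_u \<in> A_E_ideal q"
    by (simp add: relator_pbw(3)[OF t k, simplified])
  have "scalar (1 + q\<^sup>2) * relator q 1 2 + scalar (q\<^sup>2 * k) * (pbw_v * pbw_u) \<in> A_E_ideal q"
    by (intro add scale rel vu) simp_all
  then show "pbw_u * pbw_x k - scalar (q\<^sup>2) * (pbw_x k * pbw_u) + scalar k * (pbw_u * pbw_v)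
      \<in> A_E_ideal q"
    by (subst (asm) relator_pbw(1)[OF t k]) simp
  have "scalar (1 + q\<^sup>2) * relator q 2 3 - scalar (1 + k) * (pbw_v * pbw_u) \<in> A_E_ideal q"
    by (intro diff scale rel vu) simp_all
  then show "pbw_v * pbw_x k - scalar (q\<^sup>2) * (pbw_x k * pbw_v) - scalar k * (pbw_u * pbw_v)
      \<in> A_E_ideal q"
    by (subst (asm) relator_pbw(2)[OF t k]) simp
qed

text \<open>The whole ideal is included, so membership depends only on the class modulo the
  ideal.\<close>

definition normal_span :: "nat \<Rightarrow> nat nc_poly set"
  where "normal_span n = nc.span (pbw_monomial k ` monomials n \<union> A_E_ideal q)"

lemma subspace_normal_span: "nc.subspace (normal_span n)"
  by (simp add: normal_span_def)

lemmas normal_span_add = nc.subspace_add[OF subspace_normal_span]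
  and normal_span_diff = nc.subspace_diff[OF subspace_normal_span]
  and normal_span_scale = nc.subspace_scale[OF subspace_normal_span]

lemma ideal_normal_span: "p \<in> A_E_ideal q \<Longrightarrow> p \<in> normal_span n"
  by (simp add: normal_span_def nc.span_base)

lemma monomial_normal_span: "a + b + c = n \<Longrightarrow> pbw_monomial k (a, b, c) \<in> normal_span n"
  unfolding normal_span_def by (intro nc.span_base UnI1 imageI) (simp add: monomials_def)

lemma normal_span_cong: "p - r \<in> A_E_ideal q \<Longrightarrow> r \<in> normal_span n \<Longrightarrow> p \<in> normal_span n"
  using normal_span_add[OF ideal_normal_span[of "p - r" n]] by fastforce

text \<open>Right multiplication by \<open>y\<close> is linear and preserves the ideal, which leaves
  only the normal words to check.\<close>

lemma normal_span_mult:
  assumes "p \<in> normal_span n" "y \<in> carrier F"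
    and "\<And>a b c. a + b + c = n \<Longrightarrow> pbw_monomial k (a, b, c) * y \<in> normal_span n'"
  shows "p * y \<in> normal_span n'"
proof -
  have "nc.subspace {p. p * y \<in> normal_span n'}"
    using nc.subspace_0[OF subspace_normal_span]
    by (auto simp: nc.subspace_def distrib_right mult.assoc intro: normal_span_add normal_span_scale)
  then have "normal_span n \<subseteq> {p. p * y \<in> normal_span n'}"
    unfolding normal_span_def
    by (rule nc.span_minimal[rotated])
      (use assms(2,3) ideal_normal_span ideal_mult in \<open>auto simp: monomials_def normal_span_def\<close>)
  then show ?thesis using assms(1) by auto
qed

lemma monomial_mult_v: "pbw_monomial k (a, b, c) * pbw_v = pbw_monomial k (a, b, Suc c)"
  by (simp add: mult.assoc power_Suc2 del: power_Suc)

lemma monomial_mult_u: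
  "pbw_monomial k (a, b, 0) * pbw_u = pbw_monomial k (a, Suc b, 0)"
  "pbw_monomial k (a, b, Suc c) * pbw_u = pbw_monomial k (a, b, c) * (pbw_v * pbw_u)"
  by (simp_all add: mult.assoc power_Suc2 del: power_Suc)

lemma normal_span_mult_v: "p \<in> normal_span n \<Longrightarrow> p * pbw_v \<in> normal_span (Suc n)"
  by (erule normal_span_mult)
    (simp_all only: monomial_mult_v pbw_in_carrier monomial_normal_span add_Suc_right)

lemma normal_span_mult_u:
  assumes "p \<in> normal_span n" shows "p * pbw_u \<in> normal_span (Suc n)"
proof (rule normal_span_mult[OF assms])
  fix a b c assume n: "a + b + c = n"
  show "pbw_monomial k (a, b, c) * pbw_u \<in> normal_span (Suc n)"
  proof (cases c)
    case 0
    then show ?thesis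
      using n
      by (simp only: monomial_mult_u) (simp only: monomial_normal_span add_Suc_right add_Suc)
  next
    case (Suc c')
    show ?thesis
      unfolding Suc monomial_mult_u
      by (intro ideal_normal_span ideal_mult pbw_relations_in_ideal pbw_monomial_in_carrier)
  qed
qed simp

text \<open>x is moved left past the last letter u or v; the word before it is shorter, and right
  multiplication by u and v is already under control.\<close>

lemma monomial_mult_x: "a + b + c = n \<Longrightarrow> pbw_monomial k (a, b, c) * pbw_x k \<in> normal_span (Suc n)"
proof (induction "b + c" arbitrary: b c n rule: less_induct)
  case less
  note uv = normal_span_mult_v[OF normal_span_mult_u[OF monomial_normal_span]]
  show ?case
  proof (cases c)
    \<comment> \<open>The last letter is v: v x is replaced by t x v + k u v modulo the
      ideal.\<close>
    case (Suc c')
    then obtain n' where n': "n = Suc n'" "a + b + c' = n'" using less.prems by auto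
    let ?m = "pbw_monomial k (a, b, c')"
    have "?m * pbw_x k * pbw_v \<in> normal_span (Suc (Suc n'))"
      by (intro normal_span_mult_v less.hyps) (use Suc n' in auto)
    then have "scalar (q\<^sup>2) * (?m * pbw_x k * pbw_v) + scalar k * (?m * pbw_u * pbw_v)
        \<in> normal_span (Suc n)"
      unfolding n'(1) by (intro normal_span_add normal_span_scale uv n'(2))
    moreover have "?m * (pbw_v * pbw_x k - scalar (q\<^sup>2) * (pbw_x k * pbw_v) - scalar k * (pbw_u * pbw_v))
        \<in> A_E_ideal q"
      by (intro ideal_mult pbw_relations_in_ideal pbw_monomial_in_carrier)
    then have "pbw_monomial k (a, b, c) * pbw_x k
        - (scalar (q\<^sup>2) * (?m * pbw_x k * pbw_v) + scalar k * (?m * pbw_u * pbw_v)) \<in> A_E_ideal q"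
      unfolding Suc monomial_mult_v[symmetric]
      by (simp add: nc_scale_left right_diff_distrib distrib_left mult.assoc diff_diff_eq
          del: pbw_monomial.simps)
    ultimately show ?thesis by (rule normal_span_cong[rotated])
  next
    case c: 0
    show ?thesis
    proof (cases b)
      case 0
      then show ?thesis
        using monomial_normal_span[of "Suc a" 0 0 "Suc n"] c less.prems
        by (simp add: power_Suc2 del: power_Suc)
    next
      \<comment> \<open>The last letter is u: u x is replaced by t x u - k u v modulo the
        ideal.\<close>
      case (Suc b')
      then obtain n' where n': "n = Suc n'" "a + b' + 0 = n'" using less.prems c by auto
      let ?m = "pbw_monomial k (a, b', 0)"
      have "?m * pbw_x k * pbw_u \<in> normal_span (Suc (Suc n'))"
        by (intro normal_span_mult_u less.hyps) (use Suc n' in auto)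
      then have "scalar (q\<^sup>2) * (?m * pbw_x k * pbw_u) - scalar k * (?m * pbw_u * pbw_v)
          \<in> normal_span (Suc n)"
        unfolding n'(1) by (intro normal_span_diff normal_span_scale uv n'(2))
      moreover have "?m * (pbw_u * pbw_x k - scalar (q\<^sup>2) * (pbw_x k * pbw_u) + scalar k * (pbw_u * pbw_v))
          \<in> A_E_ideal q"
        by (intro ideal_mult pbw_relations_in_ideal pbw_monomial_in_carrier)
      then have "pbw_monomial k (a, b, c) * pbw_x k
          - (scalar (q\<^sup>2) * (?m * pbw_x k * pbw_u) - scalar k * (?m * pbw_u * pbw_v)) \<in> A_E_ideal q"
        unfolding Suc c monomial_mult_u(1)[symmetric]
        by (simp add: nc_scale_left right_diff_distrib distrib_left mult.assoc
            diff_diff_eq2 diff_add_eq del: pbw_monomial.simps)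
      ultimately show ?thesis by (rule normal_span_cong[rotated])
    qed
  qed
qed

lemma normal_span_mult_gen:
  assumes p: "p \<in> normal_span n" and "i \<in> {1..3}"
  shows "p * gen i \<in> normal_span (Suc n)"
proof -
  note u = normal_span_mult_u[OF p] and v = normal_span_mult_v[OF p]
    and x = normal_span_mult[OF p pbw_in_carrier(3) monomial_mult_x]
  have 1: "p * gen 1 \<in> normal_span (Suc n)"
    unfolding gen_eq_pbw(1)[of k] distrib_left nc_scale_left
    by (intro normal_span_add normal_span_scale u v x)
  have 2: "p * gen 2 \<in> normal_span (Suc n)"
    unfolding gen_eq_pbw(2)[of k] distrib_left nc_scale_left
    by (intro normal_span_add normal_span_scale u v x)
  have 3: "p * gen 3 \<in> normal_span (Suc n)"
    unfolding gen_eq_pbw(3)[of k] distrib_left nc_scale_left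
    by (intro normal_span_add normal_span_scale u v x)
  have "i \<in> {1, 2, 3}" using assms(2) by auto
  then show ?thesis using 1 2 3 by auto
qed

text \<open>Words are built by appending letters on the right, starting from the empty normal
  word.\<close>

lemma homogeneous_normal_span:
  assumes "p \<in> homogeneous_polys {1..3} d"
  shows "p \<in> normal_span d"
proof -
  have word: "Poly_Mapping.single (Free_Monoid l) 1 \<in> normal_span (length l)"
    if "set l \<subseteq> {1..3}" for l
    using that
  proof (induction l rule: rev_induct)
    case Nil
    then show ?case
      using monomial_normal_span[of 0 0 0 0] by (simp flip: zero_free_monoid_def)
  next
    case (snoc i l)
    then have "Poly_Mapping.single (Free_Monoid l) 1 * gen i \<in> normal_span (Suc (length l))"
      by (intro normal_span_mult_gen) auto
    then show ?case by (simp add: gen_def mult_single plus_free_monoid_def)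
  qed
  have "p = (\<Sum>w \<in> Poly_Mapping.keys p.
      scalar (Poly_Mapping.lookup p w) * Poly_Mapping.single w 1)"
    by (rule poly_mapping_eqI)
      (simp add: scalar_def mult_single lookup_sum lookup_single when_def in_keys_iff)
  also have "\<dots> \<in> normal_span d"
  proof (intro nc.subspace_sum subspace_normal_span normal_span_scale)
    fix w assume "w \<in> Poly_Mapping.keys p"
    then have "set (letters w) \<subseteq> {1..3}" "length (letters w) = d"
      using assms by (auto simp: homogeneous_polys_def carrier_free_algebra)
    then show "Poly_Mapping.single w 1 \<in> normal_span d" using word[of "letters w"] by simp
  qed
  finally show ?thesis .
qed

section \<open>Homogeneity of the normal words and the graded components\<close>

lemma subspace_homogeneous: "nc.subspace (homogeneous_polys {1..3::nat} d)"
proof (rule nc.subspaceI)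
  show "0 \<in> homogeneous_polys {1..3} d"
    using nc.subspace_0[OF subspace_free_algebra] by (simp add: homogeneous_polys_def)
  show "p + r \<in> homogeneous_polys {1..3} d"
    if "p \<in> homogeneous_polys {1..3} d" "r \<in> homogeneous_polys {1..3} d" for p r :: "nat nc_poly"
    using that nc.subspace_add[OF subspace_free_algebra] Poly_Mapping.keys_add[of p r]
    unfolding homogeneous_polys_def by blast
  show "scalar c * p \<in> homogeneous_polys {1..3} d"
    if "p \<in> homogeneous_polys {1..3} d" for c and p :: "nat nc_poly"
  proof -
    have "w \<in> Poly_Mapping.keys p" if w: "w \<in> Poly_Mapping.keys (scalar c * p)" for w
    proof -
      obtain u v where "w = u + v" "u \<in> Poly_Mapping.keys (scalar c)" "v \<in> Poly_Mapping.keys p"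
        using keys_mult[of "scalar c" p] w by blast
      moreover have "u = 0" using calculation(2) keys_scalar by blast
      ultimately show ?thesis by simp
    qed
    then show ?thesis
      using that nc.subspace_scale[OF subspace_free_algebra] unfolding homogeneous_polys_def by blast
  qed
qed

lemma homogeneous_mult:
  fixes p r :: "nat nc_poly"
  assumes p: "p \<in> homogeneous_polys {1..3} d" and r: "r \<in> homogeneous_polys {1..3} e"
  shows "p * r \<in> homogeneous_polys {1..3} (d + e)"
proof -
  have "length (letters w) = d + e" if w: "w \<in> Poly_Mapping.keys (p * r)" for w
  proof -
    obtain u v where "w = u + v" "u \<in> Poly_Mapping.keys p" "v \<in> Poly_Mapping.keys r"
      using keys_mult[of p r] w by blast
    then show ?thesis using p r by (simp add: homogeneous_polys_def plus_free_monoid_def)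
  qed
  then show ?thesis using p r carrier_mult by (simp add: homogeneous_polys_def)
qed

lemma homogeneous_power:
  fixes p :: "nat nc_poly"
  assumes "p \<in> homogeneous_polys {1..3} 1"
  shows "p ^ n \<in> homogeneous_polys {1..3} n"
proof (induction n)
  case 0
  show ?case
    using carrier_power[OF pbw_in_carrier(1), of 0]
    by (simp add: homogeneous_polys_def zero_free_monoid_def)
next
  case (Suc n)
  then show ?case using homogeneous_mult[OF assms Suc.IH] by (simp add: plus_1_eq_Suc)
qed

lemma pbw_monomial_homogeneous: "m \<in> monomials d \<Longrightarrow> pbw_monomial k m \<in> homogeneous_polys {1..3} d"
proof -
  assume m: "m \<in> monomials d"
  have "gen i \<in> homogeneous_polys {1..3} 1" if "i \<in> {1..3}" for i :: nat
    using that gen_in_carrier[OF that] by (simp add: homogeneous_polys_def gen_def)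
  then have g: "gen 1 \<in> homogeneous_polys {1..3::nat} 1"
    "gen 2 \<in> homogeneous_polys {1..3::nat} 1" "gen 3 \<in> homogeneous_polys {1..3::nat} 1"
    by auto
  have u: "pbw_u \<in> homogeneous_polys {1..3} 1" and v: "pbw_v \<in> homogeneous_polys {1..3} 1"
    unfolding pbw_u_def pbw_v_def by (intro nc.subspace_diff[OF subspace_homogeneous] g)+
  have x: "pbw_x k \<in> homogeneous_polys {1..3} 1"
    unfolding pbw_x_def
    by (intro nc.subspace_diff[OF subspace_homogeneous] nc.subspace_scale[OF subspace_homogeneous]
        nc.subspace_add[OF subspace_homogeneous] g u v)
  obtain a b c where abc: "m = (a, b, c)" "d = a + b + c" using m by (auto simp: monomials_def)
  show ?thesis
    unfolding abc pbw_monomial.simps by (intro homogeneous_mult homogeneous_power x u v)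
qed

text \<open>Homogeneous polynomials reduce to normal words of the same degree, and these words are
  themselves homogeneous. This brings the component into the form that
  \<open>dimension_quotient_span\<close> treats.\<close>

lemma A_E_component_eq:
  "A_E_component q d = A_E_class q ` nc.span (pbw_monomial k ` monomials d)"
proof -
  have cls: "A_E_class q p = A_E_class q r"
    if "p \<in> carrier F" "r \<in> carrier F" "p - r \<in> A_E_ideal q" for p r
    using that cls_eq_iff[OF ideal_A_E] by (simp add: A_E_class_def)
  have sub: "nc.span (pbw_monomial k ` monomials d) \<subseteq> homogeneous_polys {1..3} d"
    using pbw_monomial_homogeneous by (intro nc.span_minimal subspace_homogeneous) auto
  have "A_E_class q p \<in> A_E_class q ` nc.span (pbw_monomial k ` monomials d)"
    if p: "p \<in> homogeneous_polys {1..3} d" for p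
  proof -
    \<comment> \<open>The ideal is its own span, so an element of \<open>normal_span d\<close>
      splits into a combination of normal words and an element of the ideal.\<close>
    have span: "nc.span (A_E_ideal q) = A_E_ideal q"
      using subspace_A_E_ideal by (simp add: nc.span_eq_iff)
    then obtain r s where "p = r + s" "r \<in> nc.span (pbw_monomial k ` monomials d)" "s \<in> A_E_ideal q"
      using homogeneous_normal_span[OF p] unfolding normal_span_def nc.span_Un span by blast
    then show ?thesis
      using cls[of p r] p sub by (auto simp: homogeneous_polys_def)
  qed
  then show ?thesis unfolding A_E_component_def using sub by auto
qed

end

section \<open>Counting the normal words and computing the dimensions\<close>

lemma card_monomials: "card (monomials d) = (d + 2) choose 2"
proof -
  \<comment> \<open>The exponent a is determined by b, c and the degree.\<close>
  have eq: "monomials d = (\<lambda>(b, c). (d - b - c, b, c)) ` (SIGMA b:{..d}. {..d - b})"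
    by (auto simp: monomials_def image_iff)
  have "card (monomials d) = (\<Sum>b\<le>d. Suc (d - b))"
    unfolding eq by (subst card_image) (auto simp: inj_on_def)
  also have "\<dots> = (\<Sum>b\<le>d. Suc b)"
    by (rule sum.reindex_bij_witness[of _ "\<lambda>b. d - b" "\<lambda>b. d - b"]) auto
  also have "\<dots> = (d + 2) choose 2"
    by (induction d) (simp_all add: numeral_2_eq_2)
  finally show ?thesis .
qed

theorem proposition8:
  fixes q :: complex
  assumes "cmod q = 1" and "q \<noteq> 1" and "q \<noteq> -1" and "q \<noteq> \<i>" and "q \<noteq> -\<i>"
  shows "polynomial_algebra (A_E q) (A_E_scalars q) (A_E_component q)"
proof -
  define k where "k = q\<^sup>2 / (1 - q\<^sup>2)"
  \<comment> \<open>Excluding 1 and -1 makes the denominator of \<open>k\<close> nonzero; excluding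
    \<i> and -\<i> does so for the denominator of the relations.\<close>
  have "q\<^sup>2 \<noteq> 1" using assms by (simp add: power2_eq_1_iff)
  then have k: "k * (1 - q\<^sup>2) = q\<^sup>2" by (simp add: k_def)
  have "q\<^sup>2 \<noteq> \<i>\<^sup>2" using assms unfolding power2_eq_iff by simp
  then have t: "1 + q\<^sup>2 \<noteq> 0" by (simp add: add_eq_0_iff)
  \<comment> \<open>The coefficient of the normal word m: \<open>p\<close> acts on the indicator
    function of m, and the result is evaluated at the origin.\<close>
  define \<phi> where "\<phi> m p = gen_op.act (q\<^sup>2) k p (\<lambda>n. if m = n then 1 else 0) (0, 0, 0)" for m p
  have "ring.dimension (A_E q) ((d + 2) choose 2) (A_E_scalars q) (A_E_component q d)" for d
  proof -
    have "finite (monomials d)"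
      \<comment> \<open>An infinite set has cardinality 0, so the positive count gives
        finiteness.\<close>
      using card_monomials[of d] by (intro card_ge_0_finite) simp
    moreover have "\<phi> m p = 0" if "p \<in> A_E_ideal q" for m p
    proof -
      have "gen_op.act (q\<^sup>2) k p g = (\<lambda>m. 0)" for g
        using act_relator[OF t k]
        by (intro gen_op.act_genideal[OF relators_in_carrier[OF t k] that[unfolded A_E_ideal_def]])
          blast
      then show ?thesis by (simp add: \<phi>_def)
    qed
    moreover have "\<phi> m (pbw_monomial k n) = (if m = n then 1 else 0)" for m n
      by (cases n) (simp only: \<phi>_def act_pbw_monomial)
    ultimately show ?thesis
      unfolding A_E_component_eq[OF t k] A_E_scalars_def A_E_class_def A_E_def card_monomials[symmetric]
      by (intro dimension_quotient_span[OF ideal_A_E[OF t k], where \<phi> = \<phi>])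
        (simp_all add: \<phi>_def gen_op.act_add pbw_monomial_in_carrier[OF t k])
  qed
  then show ?thesis by (simp add: polynomial_algebra_def)
qed

end
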